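(* Let $\mathcal X$ be a separable infinite-dimensional (real or complex) Banach space, let $T: D(T)\subseteq\mathcal X\to\mathcal X$ be a linear operator, and let $Y_1,Y_2$ be linear subspaces of $Y_0=\bigcap_{n=1}^\infty D(T^n)$ such that $Y_2$ is an up-to-closure extension of $Y_1$, i.e. $Y_1\subseteq Y_2\subseteq\overline{Y_1}$. Let P be any one of the following properties: topologically transitive, weakly mixing, mixing, supermixing, relatively hypercyclic. If $(T,Y_1)$ has the property P, then $(T,Y_2)$ has the property P. Also, if $(T,Y_1)$ is hypermixing (resp. strongly topologically transitive), then $(T,Y_2)$ is supermixing (resp. topologically transitive).
   Context: $T$ is linear on a linear subspace $D(T)$ of $\mathcal X$ (bounded or unbounded). Powers are defined on their natural domains: $D(T^{n+1})=\{x\in D(T^n): T^nx\in D(T)\}$, and $T^0=I$. Closures are taken in $\mathcal X$; "open in $Y$" means open in the relative norm topology of $Y$. For $x\in Y_0$, $\mathrm{orb}(x,T)=\{x,Tx,T^2x,\dots\}$. For a linear subspace $Y\subseteq Y_0$, the pair $(T,Y)$ is called: - topologically transitive if for all nonempty open sets $U,V$ in $Y$ there is $n\ge 0$ with $T^n(U)\cap V\neq\emptyset$; - weakly mixing if $(T\oplus T,Y\oplus Y)$ is topologically transitive in $\mathcal X\oplus\mathcal X$; - mixing if for all nonempty open sets $U,V$ in $Y$ there is $N\ge 0$ with $T^n(U)\cap V\ne\emptyset$ for all $n\ge N$; - strongly topologically transitive if $Y\setminus\{0\}\subseteq\bigcup_{n=0}^\infty T^n(U)$ for every nonempty open set $U$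 in $Y$; - supermixing if $\overline Y=\overline{\big(\bigcup_{i=0}^\infty\bigcap_{n=i}^\infty T^n(U)\big)\cap Y}$ for every nonempty open set $U$ in $Y$; - hypermixing if $Y\setminus\{0\}\subseteq\bigcup_{i=0}^\infty\bigcap_{n=i}^\infty T^n(U)$ for every nonempty open set $U$ in $Y$; - relatively hypercyclic if there is a nonzero $x\in Y_0$ with $\overline{\mathrm{orb}(x,T)\cap Y}\supseteq Y$. *)

theory Defs
  imports "HOL-Analysis.Analysis"
begin

text \<open>
  A normed space over the scalar field \<open>'k\<close>. The class \<open>real_normed_field\<close> comprises, up to
  isomorphism, exactly the real and the complex field, so a statement about \<open>normed_scaling scal\<close>
  on a type of class \<open>banach\<close> covers the real case (\<open>scal = scaleR\<close>) and the complex case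
  (\<open>'k = complex\<close>), where \<open>scal\<close> is the complex scalar multiplication extending the real one.
\<close>

locale normed_scaling = vector_space scal
  for scal :: "'k::real_normed_field \<Rightarrow> 'a::real_normed_vector \<Rightarrow> 'a" +
  assumes norm_scal: "norm (scal c x) = norm c * norm x"
    and scal_of_real: "scal (of_real r) x = r *\<^sub>R x"

lemma normed_scaling_scaleR: "normed_scaling (scaleR :: real \<Rightarrow> 'a::real_normed_vector \<Rightarrow> 'a)"
  by unfold_locales (simp_all add: scaleR_add_right scaleR_add_left)

lemma normed_scaling_complex: "normed_scaling ((*) :: complex \<Rightarrow> complex \<Rightarrow> complex)"
  by unfold_locales (simp_all add: algebra_simps norm_mult scaleR_conv_of_real)

definition infinite_dimensional :: "('k::field \<Rightarrow> 'a::ab_group_add \<Rightarrow> 'a) \<Rightarrow> bool" where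
  "infinite_dimensional scal \<longleftrightarrow> \<not> (\<exists>B. finite B \<and> module.span scal B = UNIV)"

text \<open>
  An operator is a total function \<open>T\<close> together with its domain \<open>D\<close>; the values of \<open>T\<close> outside \<open>D\<close>
  are irrelevant.
\<close>

definition linear_operator ::
    "('k::field \<Rightarrow> 'a::ab_group_add \<Rightarrow> 'a) \<Rightarrow> 'a set \<Rightarrow> ('a \<Rightarrow> 'a) \<Rightarrow> bool" where
  "linear_operator scal D T \<longleftrightarrow>
     module.subspace scal D \<and>
     (\<forall>x\<in>D. \<forall>y\<in>D. T (x + y) = T x + T y) \<and>
     (\<forall>c. \<forall>x\<in>D. T (scal c x) = scal c (T x))"

primrec power_dom :: "'a set \<Rightarrow> ('a \<Rightarrow> 'a) \<Rightarrow> nat \<Rightarrow> 'a set" where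
  "power_dom D T 0 = UNIV"
| "power_dom D T (Suc n) = {x \<in> power_dom D T n. (T ^^ n) x \<in> D}"

definition all_powers_dom :: "'a set \<Rightarrow> ('a \<Rightarrow> 'a) \<Rightarrow> 'a set" where
  "all_powers_dom D T = (\<Inter>n\<in>{1..}. power_dom D T n)"

definition orb :: "'a \<Rightarrow> ('a \<Rightarrow> 'a) \<Rightarrow> 'a set" where
  "orb x T = range (\<lambda>n. (T ^^ n) x)"

text \<open>
  The properties below are meant for subspaces \<open>Y \<subseteq> all_powers_dom D T\<close>, so that \<open>(T ^^ n) ` U\<close>
  only involves genuine values of the \<open>n\<close>-th power of the operator.
\<close>

definition topologically_transitive :: "('a::topological_space \<Rightarrow> 'a) \<Rightarrow> 'a set \<Rightarrow> bool" where
  "topologically_transitive T Y \<longleftrightarrow>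
     (\<forall>U V. openin (top_of_set Y) U \<and> U \<noteq> {} \<and> openin (top_of_set Y) V \<and> V \<noteq> {} \<longrightarrow>
        (\<exists>n. (T ^^ n) ` U \<inter> V \<noteq> {}))"

definition weakly_mixing :: "('a::topological_space \<Rightarrow> 'a) \<Rightarrow> 'a set \<Rightarrow> bool" where
  "weakly_mixing T Y \<longleftrightarrow> topologically_transitive (map_prod T T) (Y \<times> Y)"

definition mixing :: "('a::topological_space \<Rightarrow> 'a) \<Rightarrow> 'a set \<Rightarrow> bool" where
  "mixing T Y \<longleftrightarrow>
     (\<forall>U V. openin (top_of_set Y) U \<and> U \<noteq> {} \<and> openin (top_of_set Y) V \<and> V \<noteq> {} \<longrightarrow>
        (\<exists>N. \<forall>n\<ge>N. (T ^^ n) ` U \<inter> V \<noteq> {}))"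

definition strongly_topologically_transitive ::
    "('a::{topological_space, zero} \<Rightarrow> 'a) \<Rightarrow> 'a set \<Rightarrow> bool" where
  "strongly_topologically_transitive T Y \<longleftrightarrow>
     (\<forall>U. openin (top_of_set Y) U \<and> U \<noteq> {} \<longrightarrow> Y - {0} \<subseteq> (\<Union>n. (T ^^ n) ` U))"

definition supermixing :: "('a::topological_space \<Rightarrow> 'a) \<Rightarrow> 'a set \<Rightarrow> bool" where
  "supermixing T Y \<longleftrightarrow>
     (\<forall>U. openin (top_of_set Y) U \<and> U \<noteq> {} \<longrightarrow>
        closure Y = closure ((\<Union>i. \<Inter>n\<in>{i..}. (T ^^ n) ` U) \<inter> Y))"

definition hypermixing :: "('a::{topological_space, zero} \<Rightarrow> 'a) \<Rightarrow> 'a set \<Rightarrow> bool" where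
  "hypermixing T Y \<longleftrightarrow>
     (\<forall>U. openin (top_of_set Y) U \<and> U \<noteq> {} \<longrightarrow>
        Y - {0} \<subseteq> (\<Union>i. \<Inter>n\<in>{i..}. (T ^^ n) ` U))"

definition relatively_hypercyclic ::
    "'a::{topological_space, zero} set \<Rightarrow> ('a \<Rightarrow> 'a) \<Rightarrow> 'a set \<Rightarrow> bool" where
  "relatively_hypercyclic D T Y \<longleftrightarrow>
     (\<exists>x\<in>all_powers_dom D T. x \<noteq> 0 \<and> Y \<subseteq> closure (orb x T \<inter> Y))"

end

theory Submission
  imports Defs
begin

text \<open>
  A nonempty relatively open subset of \<open>Y2\<close> meets the dense subspace \<open>Y1\<close> in a nonempty relatively
  open subset of \<open>Y1\<close>, and all orbit sets are monotone, so every property passes from \<open>Y1\<close> to \<open>Y2\<close>.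
  For the hypermixing and strongly transitive cases one also uses that \<open>0\<close> is not isolated in a
  nontrivial subspace, so that \<open>Y1 - {0}\<close> is still dense; the trivial subspace is treated
  separately, using \<open>T 0 = 0\<close>.
\<close>

text \<open>\<open>U\<close> is the trace on \<open>Z\<close> of an open set, and an open set that
  meets \<open>closure Y\<close> already meets \<open>Y\<close>. No linear structure enters, so the
  lemma also applies to products and to \<open>Y - {0}\<close> inside \<open>Y\<close>.\<close>

lemma openin_dense_subset_restrict:
  assumes "openin (top_of_set Z) U" "U \<noteq> {}" "Y \<subseteq> Z" "Z \<subseteq> closure Y"
  shows "openin (top_of_set Y) (U \<inter> Y)" "U \<inter> Y \<noteq> {}"
proof -
  obtain W where W: "open W" "U = Z \<inter> W"
    using assms(1) by (auto simp: openin_open)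
  then have eq: "U \<inter> Y = Y \<inter> W"
    using assms(3) by blast
  then show "openin (top_of_set Y) (U \<inter> Y)"
    using W(1) by auto
  have "W \<inter> closure Y \<noteq> {}"
    using W assms by blast
  then show "U \<inter> Y \<noteq> {}"
    using eq open_Int_closure_eq_empty[OF W(1)] by blast
qed

lemma topologically_transitive_dense_superset:
  assumes "Y \<subseteq> Z" "Z \<subseteq> closure Y" "topologically_transitive T Y"
  shows "topologically_transitive T Z"
  unfolding topologically_transitive_def
proof (intro allI impI, elim conjE)
  fix U V
  assume U: "openin (top_of_set Z) U" "U \<noteq> {}" and V: "openin (top_of_set Z) V" "V \<noteq> {}"
  obtain n where "(T ^^ n) ` (U \<inter> Y) \<inter> (V \<inter> Y) \<noteq> {}"
    using assms(3) openin_dense_subset_restrict[OF U assms(1,2)]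
      openin_dense_subset_restrict[OF V assms(1,2)]
    unfolding topologically_transitive_def by metis
  then show "\<exists>n. (T ^^ n) ` U \<inter> V \<noteq> {}"
    by blast
qed

text \<open>Closure commutes with products, so \<open>Y \<times> Y\<close> is dense in
  \<open>Z \<times> Z\<close> and the transitive case applies to
  \<open>map_prod T T\<close>.\<close>

lemma weakly_mixing_dense_superset:
  assumes "Y \<subseteq> Z" "Z \<subseteq> closure Y" "weakly_mixing T Y"
  shows "weakly_mixing T Z"
  using assms topologically_transitive_dense_superset[of "Y \<times> Y" "Z \<times> Z" "map_prod T T"]
  unfolding weakly_mixing_def by (auto simp: closure_Times)

lemma mixing_dense_superset:
  assumes "Y \<subseteq> Z" "Z \<subseteq> closure Y" "mixing T Y"
  shows "mixing T Z"
  unfolding mixing_def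
proof (intro allI impI, elim conjE)
  fix U V
  assume U: "openin (top_of_set Z) U" "U \<noteq> {}" and V: "openin (top_of_set Z) V" "V \<noteq> {}"
  obtain N where "\<forall>n\<ge>N. (T ^^ n) ` (U \<inter> Y) \<inter> (V \<inter> Y) \<noteq> {}"
    using assms(3) openin_dense_subset_restrict[OF U assms(1,2)]
      openin_dense_subset_restrict[OF V assms(1,2)]
    unfolding mixing_def by metis
  then show "\<exists>N. \<forall>n\<ge>N. (T ^^ n) ` U \<inter> V \<noteq> {}"
    by blast
qed

text \<open>The set under the right-hand closure lies in \<open>Y\<close>, so one inclusion between
  the closures is automatic; the other amounts to \<open>Y\<close> lying in a closed set.\<close>

lemma supermixing_iff:
  "supermixing T Y \<longleftrightarrow>
     (\<forall>U. openin (top_of_set Y) U \<and> U \<noteq> {} \<longrightarrow>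
        Y \<subseteq> closure ((\<Union>i. \<Inter>n\<in>{i..}. (T ^^ n) ` U) \<inter> Y))"
proof -
  have "closure Y = closure (S \<inter> Y) \<longleftrightarrow> Y \<subseteq> closure (S \<inter> Y)" for S
    by (metis Int_lower2 closed_closure closure_minimal closure_mono closure_subset subset_antisym)
  then show ?thesis
    unfolding supermixing_def by presburger
qed

lemma Union_Inter_image_mono:
  "U \<subseteq> V \<Longrightarrow> (\<Union>i. \<Inter>n\<in>{i..}. (T ^^ n) ` U) \<subseteq> (\<Union>i. \<Inter>n\<in>{i..}. (T ^^ n) ` V)"
  by (intro UN_mono INT_anti_mono image_mono subset_refl)

lemma supermixing_dense_superset:
  assumes "Y \<subseteq> Z" "Z \<subseteq> closure Y" "supermixing T Y"
  shows "supermixing T Z"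
  unfolding supermixing_iff
proof (intro allI impI, elim conjE)
  fix U
  assume U: "openin (top_of_set Z) U" "U \<noteq> {}"
  let ?S = "\<lambda>U. \<Union>i. \<Inter>n\<in>{i..}. (T ^^ n) ` U"
  have "Y \<subseteq> closure (?S (U \<inter> Y) \<inter> Y)"
    using assms(3) openin_dense_subset_restrict[OF U assms(1,2)] by (auto simp: supermixing_iff)
  also have "\<dots> \<subseteq> closure (?S U \<inter> Z)"
    using assms(1) by (intro closure_mono Int_mono Union_Inter_image_mono) auto
  finally show "Z \<subseteq> closure (?S U \<inter> Z)"
    \<comment> \<open>A closed set that contains \<open>Y\<close> contains \<open>closure Y\<close>,
      hence \<open>Z\<close>.\<close>
    using assms(2) closure_minimal[OF _ closed_closure] by blast
qed

text \<open>The same vector serves for \<open>Z\<close>, since the trace of its orbit on the set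
  only grows.\<close>

lemma relatively_hypercyclic_dense_superset:
  assumes "Y \<subseteq> Z" "Z \<subseteq> closure Y" "relatively_hypercyclic D T Y"
  shows "relatively_hypercyclic D T Z"
proof -
  obtain x where x: "x \<in> all_powers_dom D T" "x \<noteq> 0" "Y \<subseteq> closure (orb x T \<inter> Y)"
    using assms(3) by (auto simp: relatively_hypercyclic_def)
  have "closure (orb x T \<inter> Y) \<subseteq> closure (orb x T \<inter> Z)"
    using assms(1) by (intro closure_mono) auto
  then have "Z \<subseteq> closure (orb x T \<inter> Z)"
    using x(3) assms(2) closure_minimal[OF _ closed_closure] by blast
  then show ?thesis
    using x by (auto simp: relatively_hypercyclic_def)
qed

text \<open>A subspace is convex, hence connected, and a connected set with more than one point has
  no isolated points.\<close>

lemma subset_closure_minus_zero: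
  fixes Y :: "'a::real_normed_vector set"
  assumes "subspace Y" "Y \<noteq> {0}"
  shows "Y \<subseteq> closure (Y - {0})"
proof -
  have "0 islimpt Y"
    using assms subspace_0[OF assms(1)]
    by (intro connected_imp_perfect convex_connected subspace_imp_convex) auto
  then show ?thesis
    using closure_subset[of "Y - {0}"] by (auto simp: islimpt_in_closure)
qed

lemma hypermixing_imp_supermixing:
  fixes Y :: "'a::real_normed_vector set"
  assumes "subspace Y" "T 0 = 0" "hypermixing T Y"
  shows "supermixing T Y"
  unfolding supermixing_iff
proof (intro allI impI, elim conjE)
  fix U
  assume U: "openin (top_of_set Y) U" "U \<noteq> {}"
  let ?S = "\<Union>i. \<Inter>n\<in>{i..}. (T ^^ n) ` U"
  show "Y \<subseteq> closure (?S \<inter> Y)"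
  proof (cases "Y = {0}")
    \<comment> \<open>In the zero space \<open>Y - {0}\<close> is empty and hypermixing says
      nothing; instead every power of \<open>T\<close> fixes 0.\<close>
    case True
    then have "U = {0}"
      using U openin_imp_subset by blast
    moreover have "(T ^^ n) 0 = 0" for n
      by (induction n) (auto simp: assms(2))
    ultimately have "?S = {0}"
      by auto
    then show ?thesis
      using True by simp
  next
    case False
    have "Y - {0} \<subseteq> ?S \<inter> Y"
      using assms(3) U by (auto simp: hypermixing_def)
    then show ?thesis
      using subset_closure_minus_zero[OF assms(1) False] closure_mono by blast
  qed
qed

lemma strongly_topologically_transitive_imp_topologically_transitive:
  fixes Y :: "'a::real_normed_vector set"
  assumes "subspace Y" "strongly_topologically_transitive T Y"
  shows "topologically_transitive T Y"
  unfolding topologically_transitive_def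
proof (intro allI impI, elim conjE)
  fix U V
  assume U: "openin (top_of_set Y) U" "U \<noteq> {}" and V: "openin (top_of_set Y) V" "V \<noteq> {}"
  show "\<exists>n. (T ^^ n) ` U \<inter> V \<noteq> {}"
  proof (cases "Y = {0}")
    case True
    then have "U = {0}" "V = {0}"
      using U V openin_imp_subset by blast+
    then have "(T ^^ 0) ` U \<inter> V \<noteq> {}"
      by simp
    then show ?thesis ..
  next
    case False
    have "V \<inter> (Y - {0}) \<noteq> {}"
      using openin_dense_subset_restrict(2)[OF V _ subset_closure_minus_zero[OF assms(1) False]]
      by blast
    moreover have "Y - {0} \<subseteq> (\<Union>n. (T ^^ n) ` U)"
      using assms(2) U by (auto simp: strongly_topologically_transitive_def)
    ultimately show ?thesis
      by blast
  qed
qed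

text \<open>Convexity is a notion over the reals, so the density of \<open>Y - {0}\<close> needs the
  real structure, which \<open>scal\<close> extends along \<open>of_real\<close>.\<close>

lemma (in normed_scaling) subspace_imp_real_subspace:
  assumes "subspace Y"
  shows "Real_Vector_Spaces.subspace Y"
proof (rule real_vector.subspaceI)
  show "0 \<in> Y" "\<And>x y. x \<in> Y \<Longrightarrow> y \<in> Y \<Longrightarrow> x + y \<in> Y"
    using assms by (simp_all add: subspace_0 subspace_add)
  show "r *\<^sub>R x \<in> Y" if "x \<in> Y" for r x
    using subspace_scale[OF assms that, of "of_real r"] by (simp add: scal_of_real)
qed

lemma linear_operator_zero:
  assumes "module scal" "linear_operator scal D T"
  shows "T 0 = 0"
proof -
  have "0 \<in> D" "\<forall>x\<in>D. \<forall>y\<in>D. T (x + y) = T x + T y"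
    using assms module.subspace_0 by (auto simp: linear_operator_def)
  then have "T (0 + 0) = T 0 + T 0"
    by blast
  then show ?thesis
    by simp
qed

theorem proposition2p16:
  fixes scal :: "'k::real_normed_field \<Rightarrow> 'a::banach \<Rightarrow> 'a"
    and D Y1 Y2 :: "'a set" and T :: "'a \<Rightarrow> 'a"
  assumes "normed_scaling scal"
    and "separable_space (euclidean :: 'a topology)"
    and "infinite_dimensional scal"
    and "linear_operator scal D T"
    and "module.subspace scal Y1" and "Y1 \<subseteq> all_powers_dom D T"
    and "module.subspace scal Y2" and "Y2 \<subseteq> all_powers_dom D T"
    and "Y1 \<subseteq> Y2" and "Y2 \<subseteq> closure Y1"
  shows "(topologically_transitive T Y1 \<longrightarrow> topologically_transitive T Y2) \<and>
         (weakly_mixing T Y1 \<longrightarrow> weakly_mixing T Y2) \<and>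
         (mixing T Y1 \<longrightarrow> mixing T Y2) \<and>
         (supermixing T Y1 \<longrightarrow> supermixing T Y2) \<and>
         (relatively_hypercyclic D T Y1 \<longrightarrow> relatively_hypercyclic D T Y2) \<and>
         (hypermixing T Y1 \<longrightarrow> supermixing T Y2) \<and>
         (strongly_topologically_transitive T Y1 \<longrightarrow> topologically_transitive T Y2)"
proof -
  interpret normed_scaling scal
    by fact
  have Y1: "Real_Vector_Spaces.subspace Y1"
    by (rule subspace_imp_real_subspace) fact
  have T0: "T 0 = 0"
    using assms(4) by (rule linear_operator_zero[OF module_axioms])
  note dense = assms(9,10)
  \<comment> \<open>For the last two implications the weaker property is first derived on
    \<open>Y1\<close> and then carried over to \<open>Y2\<close>.\<close>
  show ?thesis
    using topologically_transitive_dense_superset[OF dense]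
      weakly_mixing_dense_superset[OF dense]
      mixing_dense_superset[OF dense]
      supermixing_dense_superset[OF dense]
      relatively_hypercyclic_dense_superset[OF dense]
      hypermixing_imp_supermixing[where T = T, OF Y1 T0]
      strongly_topologically_transitive_imp_topologically_transitive[OF Y1]
    by blast
qed

end
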